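(* Let $m,n\ge 1$ be integers and let $G=P_m\square P_n$ be a grid graph. Then $G$ is Hall-universal.
   Context: All graphs are finite and simple. For a finite set $V$, $\mathcal G(V)$ denotes the set of all finite simple undirected graphs with vertex set $V$, and $N_G(v)$ is the (open) neighborhood of $v$ in $G$. List coloring: for a graph $H$, a set of colors $S$ and $L:V(H)\to 2^S$, $H$ is $L$-colorable if there is a map $\varphi:V(H)\to S$ with $\varphi(v)\in L(v)$ for all $v$ and $\varphi(u)\ne\varphi(v)$ for every edge $uv\in E(H)$. For a subgraph $F$ of $H$ and $\sigma\in S$, $\alpha(F,L,\sigma)$ is the maximum size of an independent set $X\subseteq V(F)$ of $F$ with $\sigma\in L(v)$ for all $v\in X$. The pair $(H,L)$ satisfies Hall's condition if $|V(F)|\le\sum_{\sigma\in S}\alpha(F,L,\sigma)$ for every subgraph $F$ of $H$. Graphic lists: for $G,H\in\mathcal G(V)$, let $L(v)=N_G(v)$ for all $v\in V$ (with color set $S=V$). $H$ is $G$-colorable if $H$ is $L$-colorable, and $(H,G)$ satisfies Hall's condition if $(H,L)$ does. A graph $G\in\mathcal G(V)$ is Hall-universal if, for every $H\in\mathcal G(V)$ such that $(H,G)$ satisfies Hall's condition, $H$ is $G$-colorable. $P_m\square P_n$ is the Cartesian product of the paths on $m$ and $n$ vertices, i.e. the $m\times n$ grid graph. *)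

theory Defs
  imports "Graph_Theory.Graph_Theory"
begin

text \<open>
  Finite simple undirected graphs are rendered by the locale \<open>pair_graph\<close>: finite, loop-free
  digraphs with a symmetric arc relation, where an undirected edge \<open>uv\<close> is represented by the two
  arcs \<open>(u, v)\<close> and \<open>(v, u)\<close>.
\<close>

definition graphs_on :: "'a set \<Rightarrow> 'a pair_pre_digraph set" where
  "graphs_on V = {G. pair_graph G \<and> pverts G = V}"

definition neighborhood :: "'a pair_pre_digraph \<Rightarrow> 'a \<Rightarrow> 'a set" where
  "neighborhood G v = {u. (v, u) \<in> parcs G}"

definition independent_set :: "'a pair_pre_digraph \<Rightarrow> 'a set \<Rightarrow> bool" where
  "independent_set G X \<longleftrightarrow> X \<subseteq> pverts G \<and> (\<forall>u\<in>X. \<forall>v\<in>X. (u, v) \<notin> parcs G)"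

definition list_colorable :: "'a pair_pre_digraph \<Rightarrow> 'c set \<Rightarrow> ('a \<Rightarrow> 'c set) \<Rightarrow> bool" where
  "list_colorable H S L \<longleftrightarrow>
     (\<exists>\<phi>. (\<forall>v\<in>pverts H. \<phi> v \<in> S \<and> \<phi> v \<in> L v) \<and> (\<forall>(u, v)\<in>parcs H. \<phi> u \<noteq> \<phi> v))"

definition color_alpha :: "'a pair_pre_digraph \<Rightarrow> ('a \<Rightarrow> 'c set) \<Rightarrow> 'c \<Rightarrow> nat" where
  "color_alpha F L \<sigma> = Max (card ` {X. independent_set F X \<and> (\<forall>v\<in>X. \<sigma> \<in> L v)})"

text \<open>
  The library's \<open>subgraph\<close> relates digraphs, so that \<open>pair_graph F\<close> is required separately to
  make \<open>F\<close> an undirected subgraph; it need not be induced. The color set \<open>S\<close> is meant to be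
  finite, since \<open>sum\<close> is 0 on infinite sets.
\<close>

definition hall_condition :: "'a pair_pre_digraph \<Rightarrow> 'c set \<Rightarrow> ('a \<Rightarrow> 'c set) \<Rightarrow> bool" where
  "hall_condition H S L \<longleftrightarrow>
     (\<forall>F. pair_graph F \<and> subgraph (with_proj F) (with_proj H) \<longrightarrow>
        card (pverts F) \<le> (\<Sum>\<sigma>\<in>S. color_alpha F L \<sigma>))"

text \<open>Graphic lists: the colors are the vertices of \<open>G\<close>, and the list of \<open>v\<close> is its neighborhood.\<close>

definition graph_colorable :: "'a pair_pre_digraph \<Rightarrow> 'a pair_pre_digraph \<Rightarrow> bool" where
  "graph_colorable H G \<longleftrightarrow> list_colorable H (pverts G) (neighborhood G)"

definition graph_hall_condition :: "'a pair_pre_digraph \<Rightarrow> 'a pair_pre_digraph \<Rightarrow> bool" where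
  "graph_hall_condition H G \<longleftrightarrow> hall_condition H (pverts G) (neighborhood G)"

definition hall_universal :: "'a pair_pre_digraph \<Rightarrow> bool" where
  "hall_universal G \<longleftrightarrow> pair_graph G \<and>
     (\<forall>H\<in>graphs_on (pverts G). graph_hall_condition H G \<longrightarrow> graph_colorable H G)"

definition path_graph :: "nat \<Rightarrow> nat pair_pre_digraph" where
  "path_graph n = \<lparr> pverts = {0..<n},
     parcs = {(i, j). i < n \<and> j < n \<and> (j = Suc i \<or> i = Suc j)} \<rparr>"

definition cartesian_product ::
    "'a pair_pre_digraph \<Rightarrow> 'b pair_pre_digraph \<Rightarrow> ('a \<times> 'b) pair_pre_digraph" where
  "cartesian_product G H = \<lparr> pverts = pverts G \<times> pverts H,
     parcs = {((a, b), (a', b')).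
       (a = a' \<and> a \<in> pverts G \<and> (b, b') \<in> parcs H) \<or>
       ((a, a') \<in> parcs G \<and> b = b' \<and> b \<in> pverts H)} \<rparr>"

end

theory Submission
  imports Defs
begin

text \<open>
  A domino tiling of a set of cells assigns to each cell a neighbor, injectively, so it is a
  coloring that is proper for every \<open>H\<close>. If \<open>m\<close> or \<open>n\<close> is even, the grid has such a tiling and
  nothing remains to be shown.

  Let \<open>m\<close> and \<open>n\<close> be odd, and let \<open>E\<close> and \<open>D\<close> be the cells of even and of odd coordinate sum. Cells
  of \<open>E\<close> take colors from \<open>D\<close> and vice versa, so the two classes are colored independently. The grid
  without a corner is tileable (\<open>tileable_minus_corner\<close>), which colors \<open>D\<close> injectively and shows that
  \<open>|D| < |E|\<close>. Hall's condition for the subgraph of \<open>H\<close> induced by \<open>E\<close> then forces some color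
  \<open>\<sigma> \<in> D\<close> to be available at two cells \<open>u, w \<in> E\<close> that are not adjacent in \<open>H\<close>
  (\<open>hall_condition_common_color\<close>). Both receive the color \<open>\<sigma>\<close>, and the other cells of \<open>E\<close> are colored
  injectively by a tiling of the grid without \<open>u, \<sigma>, w\<close>.

  That tiling always exists (\<open>tileable_minus_tromino\<close>): the tromino \<open>u, \<sigma>, w\<close> lies in a block with odd
  side lengths (one by three, three by three, or three by five, up to transposition) whose upper
  left corner has even coordinates. The part of the grid outside such a block splits into rectangles with an even side
  (\<open>tileable_frame\<close>), and the block without the tromino is empty or a path or cycle of even order.
\<close>

section \<open>Domino tilings\<close>

text \<open>Adjacency in the infinite grid; \<open>fst\<close> is the row and \<open>snd\<close> the column of a cell.\<close>
definition grid_adj :: "nat \<times> nat \<Rightarrow> nat \<times> nat \<Rightarrow> bool" where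
  "grid_adj x y \<longleftrightarrow>
     (fst x = fst y \<and> (snd y = Suc (snd x) \<or> snd x = Suc (snd y))) \<or>
     (snd x = snd y \<and> (fst y = Suc (fst x) \<or> fst x = Suc (fst y)))"

text \<open>
  A tiling by dominoes is encoded as the involution that exchanges the two cells of each domino.
\<close>
definition tileable :: "(nat \<times> nat) set \<Rightarrow> bool" where
  "tileable A \<longleftrightarrow> (\<exists>f. \<forall>x\<in>A. f x \<in> A \<and> f (f x) = x \<and> grid_adj x (f x))"

lemma grid_adj_sym: "grid_adj x y \<Longrightarrow> grid_adj y x"
  by (auto simp: grid_adj_def)

lemma grid_adj_parity: "grid_adj x y \<Longrightarrow> even (fst x + snd x) \<longleftrightarrow> odd (fst y + snd y)"
  by (auto simp: grid_adj_def)

lemma grid_adj_swap: "grid_adj (prod.swap x) (prod.swap y) \<longleftrightarrow> grid_adj x y"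
  by (auto simp: grid_adj_def)

lemma tileable_empty: "tileable {}"
  by (simp add: tileable_def)

lemma tileable_Un:
  assumes "tileable A" "tileable B" "A \<inter> B = {}"
  shows "tileable (A \<union> B)"
proof -
  obtain f g where "\<forall>x\<in>A. f x \<in> A \<and> f (f x) = x \<and> grid_adj x (f x)"
      and "\<forall>x\<in>B. g x \<in> B \<and> g (g x) = x \<and> grid_adj x (g x)"
    using assms by (auto simp: tileable_def)
  with assms(3) show ?thesis
    unfolding tileable_def
    by (intro exI[of _ "\<lambda>x. if x \<in> A then f x else g x"]) auto
qed

lemma tileable_insert_domino:
  assumes "grid_adj x y" "x \<notin> A" "y \<notin> A" "tileable A"
  shows "tileable (insert x (insert y A))"
proof -
  have "tileable {x, y}"
    unfolding tileable_def using assms(1) grid_adj_sym[OF assms(1)]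
    by (intro exI[of _ "\<lambda>z. if z = x then y else x"]) auto
  with assms have "tileable ({x, y} \<union> A)"
    by (intro tileable_Un) auto
  thus ?thesis by simp
qed

lemma tileable_swap:
  assumes "tileable A"
  shows "tileable (prod.swap ` A)"
proof -
  obtain f where "\<forall>x\<in>A. f x \<in> A \<and> f (f x) = x \<and> grid_adj x (f x)"
    using assms by (auto simp: tileable_def)
  thus ?thesis
    unfolding tileable_def
    by (intro exI[of _ "prod.swap \<circ> f \<circ> prod.swap"])
       (auto simp only: comp_apply grid_adj_swap swap_swap ball_simps imageI)
qed

lemma tileable_rect_even_width:
  "tileable (I \<times> {b..<b + 2 * k})"
proof (induction k)
  case 0
  thus ?case by (simp add: tileable_empty)
next
  case (Suc k)
  let ?c = "b + 2 * k"
  have "tileable (I \<times> {?c, Suc ?c})"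
    unfolding tileable_def
    by (intro exI[of _ "\<lambda>(i, j). (i, if j = ?c then Suc ?c else ?c)"]) (auto simp: grid_adj_def)
  with Suc have "tileable (I \<times> {b..<?c} \<union> I \<times> {?c, Suc ?c})"
    by (intro tileable_Un) auto
  also have "I \<times> {b..<?c} \<union> I \<times> {?c, Suc ?c} = I \<times> {b..<b + 2 * Suc k}"
    by auto
  finally show ?case .
qed

lemma tileable_rect:
  assumes "even (c - a) \<or> even (d - b)"
  shows "tileable ({a..<c} \<times> {b..<d})"
proof -
  have *: "tileable (I \<times> {b..<d})" if "even (d - b)" for I :: "nat set" and b d
  proof (cases "b \<le> d")
    case True
    from that obtain k where "d - b = 2 * k" by blast
    with True have "d = b + 2 * k" by simp
    thus ?thesis by (simp add: tileable_rect_even_width)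
  qed (simp add: tileable_empty)
  show ?thesis
    using assms
  proof
    assume "even (c - a)"
    from tileable_swap[OF *[OF this, of "{b..<d}"]] show ?thesis
      by (simp add: product_swap)
  qed (rule *)
qed

text \<open>
  The complement of an odd block at even coordinates in an odd grid consists of the rows above and
  below the block and of the parts of the remaining rows left and right of it; each of these four
  rectangles has an even side.
\<close>
lemma tileable_frame:
  assumes "odd m" "odd n" "even a" "even b" "odd p" "odd q" "a + p \<le> m" "b + q \<le> n"
    and T: "T \<subseteq> {a..<a + p} \<times> {b..<b + q}"
    and block: "tileable ({a..<a + p} \<times> {b..<b + q} - T)"
  shows "tileable ({0..<m} \<times> {0..<n} - T)"
proof -
  let ?top = "{0..<a} \<times> {0..<n}" and ?bottom = "{a + p..<m} \<times> {0..<n}"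
  let ?left = "{a..<a + p} \<times> {0..<b}" and ?right = "{a..<a + p} \<times> {b + q..<n}"
  let ?R = "{a..<a + p} \<times> {b..<b + q}"
  let ?F = "?top \<union> (?bottom \<union> (?left \<union> ?right))"
  have "tileable ?top" "tileable ?bottom" "tileable ?left" "tileable ?right"
    using assms by (auto intro!: tileable_rect)
  hence "tileable ?F"
    by (intro tileable_Un) (auto simp: disjoint_iff)
  have grid: "{0..<m} \<times> {0..<n} = ?F \<union> ?R"
    using assms(7,8) by auto
  have disj: "?F \<inter> ?R = {}"
    by (auto simp: disjoint_iff)
  have "F \<inter> (R - T) = {}" "F \<union> (R - T) = F \<union> R - T" if "F \<inter> R = {}" "T \<subseteq> R"
    for F R :: "(nat \<times> nat) set"
    using that by blast+
  note diff = this[OF disj T]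
  from tileable_Un[OF \<open>tileable ?F\<close> block diff(1)] show ?thesis
    unfolding grid diff(2) .
qed

lemma tileable_minus_corner:
  assumes "odd m" "odd n"
  shows "tileable ({0..<m} \<times> {0..<n} - {(0, 0)})"
  by (rule tileable_frame[where a = 0 and b = 0 and p = 1 and q = 1])
     (use assms odd_pos[OF assms(1)] odd_pos[OF assms(2)] in \<open>auto simp: tileable_empty\<close>)

lemma atLeastLessThan_add_3: "{a..<a + 3} = {a, a + 1, a + 2}" for a :: nat
  by auto

lemma atLeastLessThan_add_5: "{a..<a + 5} = {a, a + 1, a + 2, a + 3, a + 4}" for a :: nat
  by auto

text \<open>
  In a block of three by three cells, removing the center, a corner, and the middle cell of the top
  or bottom side between them leaves a path of six cells.
\<close>
lemma tileable_block_3_3: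
  fixes a b :: nat
  defines "B \<equiv> {a..<a + 3} \<times> {b..<b + 3}"
  shows "tileable (B - {(a, b), (a, b + 1), (a + 1, b + 1)})" (is ?L_top)
    and "tileable (B - {(a, b + 2), (a, b + 1), (a + 1, b + 1)})" (is ?R_top)
    and "tileable (B - {(a + 2, b), (a + 2, b + 1), (a + 1, b + 1)})" (is ?L_bottom)
    and "tileable (B - {(a + 2, b + 2), (a + 2, b + 1), (a + 1, b + 1)})" (is ?R_bottom)
proof -
  have "B - {(a, b), (a, b + 1), (a + 1, b + 1)} =
      {(a, b + 2), (a + 1, b + 2), (a + 2, b + 2), (a + 2, b + 1), (a + 2, b), (a + 1, b)}"
    unfolding B_def atLeastLessThan_add_3 by auto
  also have "tileable \<dots>"
    by (intro tileable_insert_domino tileable_empty) (auto simp: grid_adj_def)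
  finally show ?L_top .
  have "B - {(a, b + 2), (a, b + 1), (a + 1, b + 1)} =
      {(a, b), (a + 1, b), (a + 2, b), (a + 2, b + 1), (a + 2, b + 2), (a + 1, b + 2)}"
    unfolding B_def atLeastLessThan_add_3 by auto
  also have "tileable \<dots>"
    by (intro tileable_insert_domino tileable_empty) (auto simp: grid_adj_def)
  finally show ?R_top .
  have "B - {(a + 2, b), (a + 2, b + 1), (a + 1, b + 1)} =
      {(a + 2, b + 2), (a + 1, b + 2), (a, b + 2), (a, b + 1), (a, b), (a + 1, b)}"
    unfolding B_def atLeastLessThan_add_3 by auto
  also have "tileable \<dots>"
    by (intro tileable_insert_domino tileable_empty) (auto simp: grid_adj_def)
  finally show ?L_bottom .
  have "B - {(a + 2, b + 2), (a + 2, b + 1), (a + 1, b + 1)} =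
      {(a + 2, b), (a + 1, b), (a, b), (a, b + 1), (a, b + 2), (a + 1, b + 2)}"
    unfolding B_def atLeastLessThan_add_3 by auto
  also have "tileable \<dots>"
    by (intro tileable_insert_domino tileable_empty) (auto simp: grid_adj_def)
  finally show ?R_bottom .
qed

text \<open>Removing the interior of the block leaves the cycle of its twelve boundary cells.\<close>
lemma tileable_block_5_3:
  "tileable ({a..<a + 5} \<times> {b..<b + 3} - {(a + 1, b + 1), (a + 2, b + 1), (a + 3, b + 1)})"
proof -
  have "{a..<a + 5} \<times> {b..<b + 3} - {(a + 1, b + 1), (a + 2, b + 1), (a + 3, b + 1)} =
      {(a, b), (a, b + 1), (a, b + 2), (a + 1, b + 2), (a + 2, b + 2), (a + 3, b + 2),
       (a + 4, b + 2), (a + 4, b + 1), (a + 4, b), (a + 3, b), (a + 2, b), (a + 1, b)}"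
    unfolding atLeastLessThan_add_3 atLeastLessThan_add_5 by auto
  also have "tileable \<dots>"
    by (intro tileable_insert_domino tileable_empty) (auto simp: grid_adj_def)
  finally show ?thesis .
qed

text \<open>
  The middle cell \<open>(i, j)\<close> of the tromino is in an even row and an odd column, so its neighbors on
  the left and right have two even coordinates and those above and below have two odd ones. If one
  of the latter is removed, the parity of \<open>m\<close> leaves a further row beyond it for the block.
\<close>
lemma tileable_minus_tromino_even_row:
  assumes m: "odd m" and n: "odd n" and ij: "even i" "odd j" "i < m" "j < n"
    and uw: "u \<noteq> w" "grid_adj (i, j) u" "grid_adj (i, j) w"
      "u \<in> {0..<m} \<times> {0..<n}" "w \<in> {0..<m} \<times> {0..<n}"
  shows "tileable ({0..<m} \<times> {0..<n} - {u, (i, j), w})"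
proof -
  obtain b where b: "j = b + 1" "even b"
    using ij(2) by (metis Suc_eq_plus1 even_Suc odd_pos gr0_implies_Suc)
  have bn: "b + 3 \<le> n"
    using b ij(4) n by (cases "n = b + 2") auto
  have below: "i + 3 \<le> m" if "i + 1 < m"
    using that ij(1) m by (cases "m = i + 2") auto
  have above: "\<exists>a. even a \<and> i = a + 2" if "i \<ge> 1"
    using that ij(1) by (intro exI[of _ "i - 2"]) (cases "i = 1", auto)
  \<comment> \<open>\<open>?U\<close> is a cell above \<open>?s\<close> only if \<open>i \<ge> 1\<close>, since subtraction is truncated.\<close>
  let ?L = "(i, b)" and ?R = "(i, b + 2)" and ?U = "(i - 1, b + 1)" and ?D = "(i + 1, b + 1)"
  let ?G = "{0..<m} \<times> {0..<n}" and ?s = "(i, b + 1)"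
  have LR: "tileable (?G - {?L, ?s, ?R})"
    by (rule tileable_frame[where a = i and b = b and p = 1 and q = 3])
       (use m n ij b bn in \<open>auto simp: atLeastLessThan_add_3 tileable_empty\<close>)
  have frame3: "tileable (?G - T)"
    if "tileable ({a..<a + 3} \<times> {b..<b + 3} - T)" "T \<subseteq> {a..<a + 3} \<times> {b..<b + 3}"
      "even a" "a + 3 \<le> m" for a T
    by (rule tileable_frame[where a = a and b = b and p = 3 and q = 3])
       (use m n b bn that in simp_all)
  have D: "tileable (?G - {?L, ?s, ?D})" "tileable (?G - {?R, ?s, ?D})" if "i + 1 < m"
    by (rule frame3[OF tileable_block_3_3(1)] frame3[OF tileable_block_3_3(2)];
        use ij below[OF that] in simp)+
  have U: "tileable (?G - {?L, ?s, ?U})" "tileable (?G - {?R, ?s, ?U})" if i: "i \<ge> 1"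
  proof -
    obtain a where a: "even a" "i = a + 2"
      using above[OF i] by blast
    have "tileable (?G - {(a + 2, b), (a + 2, b + 1), (a + 1, b + 1)})"
         "tileable (?G - {(a + 2, b + 2), (a + 2, b + 1), (a + 1, b + 1)})"
      by (rule frame3[OF tileable_block_3_3(3)] frame3[OF tileable_block_3_3(4)];
          use ij a in simp)+
    thus "tileable (?G - {?L, ?s, ?U})" "tileable (?G - {?R, ?s, ?U})"
      by (simp_all add: a(2))
  qed
  have UD: "tileable (?G - {?U, ?s, ?D})" if i: "i \<ge> 1" "i + 1 < m"
  proof -
    obtain a where a: "even a" "i = a + 2"
      using above[OF i(1)] by blast
    have "tileable (?G - {(a + 1, b + 1), (a + 2, b + 1), (a + 3, b + 1)})"
      by (rule tileable_frame[OF m n a(1) b(2) _ _ _ bn _ tileable_block_5_3])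
         (use below[OF i(2)] a in simp_all)
    thus ?thesis
      by (simp add: a(2) eval_nat_numeral)
  qed
  have nb: "v \<in> {?L, ?R} \<or> (v = ?U \<and> i \<ge> 1) \<or> (v = ?D \<and> i + 1 < m)"
    if "grid_adj (i, j) v" "v \<in> ?G" for v
    using that b by (cases v) (auto simp: grid_adj_def)
  show ?thesis
    using nb[OF uw(2,4)] nb[OF uw(3,5)] uw(1) LR D U UD b(1)
    by (elim disjE insertE emptyE conjE) (simp_all add: insert_commute)
qed

lemma tileable_minus_tromino:
  assumes m: "odd m" and n: "odd n" and s: "odd (fst s + snd s)" "s \<in> {0..<m} \<times> {0..<n}"
    and uw: "u \<noteq> w" "grid_adj s u" "grid_adj s w"
      "u \<in> {0..<m} \<times> {0..<n}" "w \<in> {0..<m} \<times> {0..<n}"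
  shows "tileable ({0..<m} \<times> {0..<n} - {u, s, w})"
proof (cases "even (fst s)")
  case True
  with tileable_minus_tromino_even_row[of m n "fst s" "snd s" u w] assms show ?thesis by auto
next
  case False
  have "tileable ({0..<n} \<times> {0..<m} -
      {prod.swap u, (fst (prod.swap s), snd (prod.swap s)), prod.swap w})"
  proof (rule tileable_minus_tromino_even_row)
    show "grid_adj (fst (prod.swap s), snd (prod.swap s)) (prod.swap u)"
         "grid_adj (fst (prod.swap s), snd (prod.swap s)) (prod.swap w)"
      using uw(2,3) by (simp_all only: prod.collapse grid_adj_swap)
  qed (use False assms in \<open>auto simp: prod_eq_iff\<close>)
  from tileable_swap[OF this] show ?thesis
    by (simp add: image_set_diff product_swap)
qed

section \<open>The grid graph\<close>

text \<open>The grid graph with \<open>m\<close> rows and \<open>n\<close> columns.\<close>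
abbreviation (input) grid :: "nat \<Rightarrow> nat \<Rightarrow> (nat \<times> nat) pair_pre_digraph" where
  "grid m n \<equiv> cartesian_product (path_graph m) (path_graph n)"

lemma pverts_grid: "pverts (grid m n) = {0..<m} \<times> {0..<n}"
  by (simp add: cartesian_product_def path_graph_def)

lemma parcs_grid:
  "(x, y) \<in> parcs (grid m n) \<longleftrightarrow>
     x \<in> {0..<m} \<times> {0..<n} \<and> y \<in> {0..<m} \<times> {0..<n} \<and> grid_adj x y"
  by (cases x; cases y) (auto simp: cartesian_product_def path_graph_def grid_adj_def)

lemma neighborhood_grid:
  "y \<in> neighborhood (grid m n) x \<longleftrightarrow>
     x \<in> {0..<m} \<times> {0..<n} \<and> y \<in> {0..<m} \<times> {0..<n} \<and> grid_adj x y"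
  by (simp add: neighborhood_def parcs_grid)

lemma pair_graph_grid: "pair_graph (grid m n)"
proof
  let ?V = "{0..<m} \<times> {0..<n}"
  show "finite (pverts (grid m n))"
    by (simp add: pverts_grid)
  show "finite (parcs (grid m n))"
    by (rule finite_subset[of _ "?V \<times> ?V"]) (auto simp: parcs_grid simp del: mem_Sigma_iff)
qed (auto simp: pverts_grid parcs_grid grid_adj_def symmetric_def sym_def)

section \<open>Hall's condition\<close>

lemma color_alpha_le:
  assumes "finite (pverts F)"
    and "\<And>X. independent_set F X \<Longrightarrow> \<forall>v\<in>X. \<sigma> \<in> L v \<Longrightarrow> card X \<le> k"
  shows "color_alpha F L \<sigma> \<le> k"
proof -
  let ?I = "{X. independent_set F X \<and> (\<forall>v\<in>X. \<sigma> \<in> L v)}"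
  have "finite ?I"
    by (rule finite_subset[of _ "Pow (pverts F)"]) (use assms(1) in \<open>auto simp: independent_set_def\<close>)
  moreover have "{} \<in> ?I"
    by (simp add: independent_set_def)
  ultimately show ?thesis
    unfolding color_alpha_def using assms(2) by (subst Max_le_iff) auto
qed

text \<open>
  If the lists on \<open>A\<close> offer fewer than \<open>|A|\<close> colors altogether, Hall's condition for the subgraph
  induced by \<open>A\<close> can only hold if some color has an independent set of size at least two.
\<close>
lemma hall_condition_common_color:
  assumes "pair_graph H" and hall: "hall_condition H S L" and "finite S"
    and A: "A \<subseteq> pverts H" and C: "C \<subseteq> S" "card C < card A"
    and L: "\<And>v. v \<in> A \<Longrightarrow> L v \<inter> S \<subseteq> C"
  obtains u w \<sigma> where "u \<in> A" "w \<in> A" "u \<noteq> w" "(u, w) \<notin> parcs H" "\<sigma> \<in> C" "\<sigma> \<in> L u" "\<sigma> \<in> L w"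
proof (rule ccontr)
  assume "\<not> thesis"
  with that have adj: "(u, w) \<in> parcs H"
    if "u \<in> A" "w \<in> A" "u \<noteq> w" "\<sigma> \<in> C" "\<sigma> \<in> L u" "\<sigma> \<in> L w" for u w \<sigma>
    using that by blast
  interpret H: pair_graph H by fact
  define F where "F = \<lparr>pverts = A, parcs = {e \<in> parcs H. fst e \<in> A \<and> snd e \<in> A}\<rparr>"
  have "finite A"
    using A H.pair_finite_verts by (rule finite_subset)
  interpret F: pair_graph F
    by unfold_locales
       (use \<open>finite A\<close> H.pair_finite_arcs H.pair_no_loops H.pair_sym_arcs in
         \<open>auto simp: F_def symmetric_def sym_def\<close>)
  have "subgraph (with_proj F) (with_proj H)"
    unfolding subgraph_def
    using A F.wf_digraph_axioms H.wf_digraph_axioms by (auto simp: F_def compatible_def)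
  with hall F.pair_graph_axioms have "card A \<le> (\<Sum>\<sigma>\<in>S. color_alpha F L \<sigma>)"
    unfolding hall_condition_def by (metis F_def pair_pre_digraph.select_convs(1))
  also have "\<dots> \<le> (\<Sum>\<sigma>\<in>S. if \<sigma> \<in> C then 1 else 0)"
  proof (intro sum_mono color_alpha_le)
    show "finite (pverts F)" by (rule F.pair_finite_verts)
    fix \<sigma> X
    assume \<sigma>: "\<sigma> \<in> S" and X: "independent_set F X" "\<forall>v\<in>X. \<sigma> \<in> L v"
    have XA: "X \<subseteq> A" and indep: "\<And>u w. u \<in> X \<Longrightarrow> w \<in> X \<Longrightarrow> (u, w) \<notin> parcs H"
      using X(1) by (auto simp: independent_set_def F_def)
    show "card X \<le> (if \<sigma> \<in> C then 1 else 0)"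
    proof (cases "\<sigma> \<in> C")
      case True
      have "finite X"
        using XA \<open>finite A\<close> by (rule finite_subset)
      hence "card X \<le> Suc 0"
        using adj[OF _ _ _ True] XA X(2) indep by (subst card_le_Suc0_iff_eq) blast+
      with True show ?thesis by simp
    next
      case False
      with \<sigma> X(2) XA L have "X = {}" by blast
      thus ?thesis by simp
    qed
  qed
  also have "\<dots> = card C"
    using C(1) \<open>finite S\<close> by (simp add: sum.If_cases Int_absorb1)
  finally show False
    using C(2) by simp
qed

section \<open>Hall-universality of grids\<close>

theorem theorem4p18:
  fixes m n :: nat
  assumes "m \<ge> 1" and "n \<ge> 1"
  shows "hall_universal (cartesian_product (path_graph m) (path_graph n))"
  unfolding hall_universal_def
proof (intro conjI ballI impI)
  define V where "V = {0..<m} \<times> {0..<n}"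
  show "pair_graph (grid m n)" by (rule pair_graph_grid)
  fix H
  assume "H \<in> graphs_on (pverts (grid m n))" and hall: "graph_hall_condition H (grid m n)"
  hence "pair_graph H" and V: "pverts H = V"
    by (simp_all add: graphs_on_def pverts_grid V_def)
  interpret H: pair_graph H by fact
  have colorableI: "graph_colorable H (grid m n)"
    if "\<And>v. v \<in> V \<Longrightarrow> \<phi> v \<in> V \<and> grid_adj v (\<phi> v)"
      and "\<And>u v. (u, v) \<in> parcs H \<Longrightarrow> \<phi> u \<noteq> \<phi> v" for \<phi>
    unfolding graph_colorable_def list_colorable_def V neighborhood_grid pverts_grid
      V_def[symmetric]
    using that by (intro exI[of _ \<phi>]) auto
  have arc: "u \<in> V" "v \<in> V" "u \<noteq> v" "(v, u) \<in> parcs H" if uv: "(u, v) \<in> parcs H" for u v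
  proof -
    show "u \<in> V" "v \<in> V" "u \<noteq> v"
      using H.arc_fst_in_verts[OF uv] H.arc_snd_in_verts[OF uv] H.pair_no_loops[OF uv] V
      by (simp_all only: fst_conv snd_conv not_False_eq_True)
    have "sym (parcs H)"
      using H.pair_sym_arcs by (simp add: symmetric_def)
    thus "(v, u) \<in> parcs H"
      using uv by (rule symD)
  qed
  show "graph_colorable H (grid m n)"
  proof (cases "even m \<or> even n")
    case True
    hence "tileable V" unfolding V_def by (intro tileable_rect) simp
    then obtain f where f: "\<forall>x\<in>V. f x \<in> V \<and> f (f x) = x \<and> grid_adj x (f x)"
      unfolding tileable_def ..
    show ?thesis
    proof (rule colorableI)
      show "f v \<in> V \<and> grid_adj v (f v)" if "v \<in> V" for v
        using f that by blast
      show "f u \<noteq> f v" if "(u, v) \<in> parcs H" for u v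
        using arc[OF that] f by metis
    qed
  next
    case False
    hence odd: "odd m" "odd n" by auto
    define E where "E = {x \<in> V. even (fst x + snd x)}"
    define D where "D = {x \<in> V. odd (fst x + snd x)}"
    have ED: "V = E \<union> D" "E \<inter> D = {}"
      by (auto simp: E_def D_def)
    have fin: "finite E" "finite D"
      by (auto simp: E_def D_def V_def)
    have adj_E: "y \<in> D" if "x \<in> E" "y \<in> V" "grid_adj x y" for x y
      using that grid_adj_parity[of x y] by (simp add: E_def D_def)
    have adj_D: "y \<in> E" if "x \<in> D" "y \<in> V" "grid_adj x y" for x y
      using that grid_adj_parity[of x y] by (simp add: E_def D_def)
    have origin: "(0, 0) \<in> E"
      using assms by (simp add: E_def V_def)
    obtain g where g: "\<forall>x \<in> V - {(0, 0)}.
        g x \<in> V - {(0, 0)} \<and> g (g x) = x \<and> grid_adj x (g x)"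
      using tileable_minus_corner[OF odd] unfolding V_def tileable_def ..
    have gD: "g x \<in> E - {(0, 0)}" "g (g x) = x" "grid_adj x (g x)" if "x \<in> D" for x
    proof -
      have "x \<in> V - {(0, 0)}" using that origin ED by blast
      from bspec[OF g this] show "g x \<in> E - {(0, 0)}" "g (g x) = x" "grid_adj x (g x)"
        using adj_D[OF that, of "g x"] by auto
    qed
    \<comment> \<open>The tiling \<open>g\<close> misses the origin, which is in \<open>E\<close>, so it embeds \<open>D\<close> properly into \<open>E\<close>.\<close>
    have inj: "inj_on g D"
      by (rule inj_on_inverseI[of _ g]) (rule gD)
    have "card D \<le> card (E - {(0, 0)})"
      by (rule card_inj_on_le[OF inj image_subsetI[OF gD(1)]]) (use fin in simp_all)
    also have "\<dots> < card E"
      using origin fin by (intro card_Diff1_less)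
    finally have card: "card D < card E" .
    obtain u w \<sigma> where uw: "u \<in> E" "w \<in> E" "u \<noteq> w" "(u, w) \<notin> parcs H" and \<sigma>: "\<sigma> \<in> D"
      and "\<sigma> \<in> neighborhood (grid m n) u" "\<sigma> \<in> neighborhood (grid m n) w"
    proof (rule hall_condition_common_color[OF \<open>pair_graph H\<close> _ _ _ _ card])
      show "hall_condition H (pverts (grid m n)) (neighborhood (grid m n))"
        using hall by (simp only: graph_hall_condition_def)
      show "neighborhood (grid m n) v \<inter> pverts (grid m n) \<subseteq> D" if "v \<in> E" for v
        using adj_E[OF that] by (auto simp: neighborhood_grid V_def)
      show "E \<subseteq> pverts H"
        using ED V by blast
      show "finite (pverts (grid m n))" "D \<subseteq> pverts (grid m n)"
        using ED fin unfolding pverts_grid V_def[symmetric] by simp_all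
    qed
    hence u\<sigma>: "grid_adj u \<sigma>" and w\<sigma>: "grid_adj w \<sigma>"
      by (simp_all add: neighborhood_grid)
    have "tileable (V - {u, \<sigma>, w})"
    proof (rule tileable_minus_tromino[OF odd _ _ uw(3) grid_adj_sym[OF u\<sigma>] grid_adj_sym[OF w\<sigma>],
          folded V_def])
      show "odd (fst \<sigma> + snd \<sigma>)"
        using \<sigma> by (simp add: D_def)
      show "\<sigma> \<in> V" "u \<in> V" "w \<in> V"
        using \<sigma> uw(1,2) ED by simp_all
    qed
    then obtain f where f: "\<forall>x \<in> V - {u, \<sigma>, w}.
        f x \<in> V - {u, \<sigma>, w} \<and> f (f x) = x \<and> grid_adj x (f x)"
      unfolding tileable_def ..
    have fE: "f x \<in> D - {\<sigma>}" "f (f x) = x" "grid_adj x (f x)" if "x \<in> E" "x \<noteq> u" "x \<noteq> w" for x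
    proof -
      have "x \<in> V - {u, \<sigma>, w}" using that \<sigma> ED by blast
      from bspec[OF f this] show "f x \<in> D - {\<sigma>}" "f (f x) = x" "grid_adj x (f x)"
        using adj_E[OF that(1), of "f x"] by auto
    qed
    \<comment> \<open>Only \<open>u\<close> and \<open>w\<close> share a color; the tiling \<open>f\<close> never assigns \<open>\<sigma>\<close>.\<close>
    define \<phi> where "\<phi> x = (if x \<in> D then g x else if x = u \<or> x = w then \<sigma> else f x)" for x
    have \<phi>_D: "\<phi> x = g x" if "x \<in> D" for x
      using that by (simp add: \<phi>_def)
    have \<phi>_uw: "\<phi> x = \<sigma>" if "x = u \<or> x = w" for x
      using that uw ED by (auto simp: \<phi>_def)
    have \<phi>_E: "\<phi> x = f x" if "x \<in> E" "x \<noteq> u" "x \<noteq> w" for x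
      using that ED by (auto simp: \<phi>_def)
    have color_E: "\<phi> x \<in> D" if "x \<in> E" for x
      using \<phi>_uw \<phi>_E[OF that] fE(1)[OF that] \<sigma> by (cases "x = u \<or> x = w") auto
    have color_D: "\<phi> x \<in> E" if "x \<in> D" for x
      using \<phi>_D gD(1) that by auto
    show ?thesis
    proof (rule colorableI)
      fix v assume "v \<in> V"
      then consider "v \<in> D" | "v = u \<or> v = w" | "v \<in> E" "v \<noteq> u" "v \<noteq> w"
        using ED by blast
      hence "grid_adj v (\<phi> v)"
        using \<phi>_D \<phi>_uw \<phi>_E gD(3) fE(3) u\<sigma> w\<sigma> by cases auto
      moreover have "\<phi> v \<in> V"
        using color_E color_D \<open>v \<in> V\<close> ED by blast
      ultimately show "\<phi> v \<in> V \<and> grid_adj v (\<phi> v)" by blast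
    next
      fix x y assume xy: "(x, y) \<in> parcs H"
      note xy = arc[OF xy] xy
      show "\<phi> x \<noteq> \<phi> y"
      proof (cases "x \<in> D \<longleftrightarrow> y \<in> D")
        case False
        with xy(1,2) ED color_E color_D show ?thesis
          by (metis UnE disjoint_iff)
      next
        case same: True
        show ?thesis
        proof (cases "x \<in> D")
          case True
          with same inj xy(3) show ?thesis
            by (simp add: \<phi>_D inj_on_eq_iff)
        next
          case False
          with same xy(1,2) ED have E: "x \<in> E" "y \<in> E" by auto
          have "\<not> ((x = u \<or> x = w) \<and> (y = u \<or> y = w))"
            using xy(3-5) uw(4) by auto
          then consider "x = u \<or> x = w" "y \<noteq> u" "y \<noteq> w" | "x \<noteq> u" "x \<noteq> w" "y = u \<or> y = w"
            | "x \<noteq> u" "x \<noteq> w" "y \<noteq> u" "y \<noteq> w"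
            by blast
          thus ?thesis
          proof cases
            case 1
            with E show ?thesis using \<phi>_uw[OF 1(1)] \<phi>_E[of y] fE(1)[of y] by auto
          next
            case 2
            with E show ?thesis using \<phi>_uw[OF 2(3)] \<phi>_E[of x] fE(1)[of x] by auto
          next
            case 3
            with E show ?thesis using \<phi>_E fE(2) xy(3) by metis
          qed
        qed
      qed
    qed
  qed
qed

end
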